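(* Let $(H;\langle\cdot,\cdot\rangle)$ be an inner product space over $\mathbb{K}$ and $x,y,e\in H$ with $\|e\|=1$. If $r_1,r_2>0$ and $$\|x-e\|\le r_1,\qquad \|y-e\|\le r_2,$$ then $$|\langle x,y\rangle-\langle x,e\rangle\langle e,y\rangle|\le \frac12 r_1r_2\sqrt{\|x\|+|\langle x,e\rangle|}\cdot\sqrt{\|y\|+|\langle y,e\rangle|}\le r_1r_2\sqrt{\|x\|\,\|y\|} .$$ The constant $\frac12$ is best possible, in the sense that it cannot be replaced by a smaller constant: there is no $c<\frac12$ such that the first inequality holds with $c$ in place of $\frac12$ for all inner product spaces $H$ over $\mathbb{K}$ and all $x,y,e\in H$, $r_1,r_2>0$ with $\|e\|=1$, $\|x-e\|\le r_1$ and $\|y-e\|\le r_2$.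
   Context: $\mathbb{K}$ denotes $\mathbb{R}$ or $\mathbb{C}$. Inner products are linear in the first argument and conjugate-linear in the second, and $\|x\|=\langle x,x\rangle^{1/2}$. *)

theory Defs
  imports "HOL-Analysis.Inner_Product" "HOL-Algebra.Module"
begin

text \<open>
  Inner product spaces are records with an explicit carrier (a vector space is a
  \<open>module\<close> over a field), so that a formula can quantify over all of
  them; type classes such as \<open>real_inner\<close> do not allow this. The scalar
  field is a set \<open>K\<close> of complex numbers, either \<open>\<real>\<close> or
  \<open>UNIV\<close>. For \<open>K = \<real>\<close>, \<open>cnj\<close> is the identity on
  \<open>K\<close> and \<open>cmod\<close> is the absolute value.

  A formula still ranges over carriers inside one type only. To refute that a constant
  works for all inner product spaces over \<open>K\<close>, carriers inside
  \<open>nat \<Rightarrow> complex\<close> are used; these include copies of all finite-dimensional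
  spaces, and refuting the claim on them refutes it in general.
\<close>

definition scalar_field :: "complex set \<Rightarrow> complex ring" where
  "scalar_field K = \<lparr>carrier = K, monoid.mult = (*), one = 1, zero = 0, add = (+)\<rparr>"

text \<open>The fields \<open>mult\<close> and \<open>one\<close> inherited from \<open>ring\<close> are not used.\<close>

record 'v ip_space = "(complex, 'v) module" +
  ip :: "'v \<Rightarrow> 'v \<Rightarrow> complex" (\<open>(\<open>open_block notation=\<open>mixfix ip\<close>\<close>\<langle>_,/ _\<rangle>\<index>)\<close>)

definition ip_norm :: "('v, 'm) ip_space_scheme \<Rightarrow> 'v \<Rightarrow> real"
    (\<open>(\<open>open_block notation=\<open>mixfix ip_norm\<close>\<close>\<parallel>_\<parallel>\<index>)\<close>) where
  "ip_norm H x = sqrt (Re (ip H x x))"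

text \<open>
  Conjugate-linearity in the second argument follows from \<open>ip_add\<close>,
  \<open>ip_smult\<close> and \<open>ip_cnj\<close>. By \<open>ip_cnj\<close>, \<open>\<langle>x, x\<rangle>\<close>
  is real, so positivity and the norm can refer to its real part.
\<close>

locale inner_product_space =
  Module.module "scalar_field K" H for K :: "complex set" and H (structure) +
  assumes K_cases: "K = \<real> \<or> K = UNIV"
    and ip_closed: "x \<in> carrier H \<Longrightarrow> y \<in> carrier H \<Longrightarrow> \<langle>x, y\<rangle> \<in> K"
    and ip_add: "x \<in> carrier H \<Longrightarrow> y \<in> carrier H \<Longrightarrow> z \<in> carrier H \<Longrightarrow>
      \<langle>x \<oplus> y, z\<rangle> = \<langle>x, z\<rangle> + \<langle>y, z\<rangle>"
    and ip_smult: "a \<in> K \<Longrightarrow> x \<in> carrier H \<Longrightarrow> y \<in> carrier H \<Longrightarrow>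
      \<langle>a \<odot> x, y\<rangle> = a * \<langle>x, y\<rangle>"
    and ip_cnj: "x \<in> carrier H \<Longrightarrow> y \<in> carrier H \<Longrightarrow> \<langle>y, x\<rangle> = cnj \<langle>x, y\<rangle>"
    and ip_pos: "x \<in> carrier H \<Longrightarrow> x \<noteq> \<zero> \<Longrightarrow> 0 < Re \<langle>x, x\<rangle>"

lemma cring_scalar_field:
  assumes "K = \<real> \<or> K = UNIV"
  shows "cring (scalar_field K)"
proof (intro cringI abelian_groupI comm_monoidI)
  fix x assume "x \<in> carrier (scalar_field K)"
  then have "- x \<in> carrier (scalar_field K)"
    using assms by (auto simp: scalar_field_def)
  then show "\<exists>y\<in>carrier (scalar_field K). y \<oplus>\<^bsub>scalar_field K\<^esub> x = \<zero>\<^bsub>scalar_field K\<^esub>"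
    by (intro bexI[of _ "- x"]) (simp_all add: scalar_field_def)
qed (use assms in \<open>auto simp: scalar_field_def algebra_simps\<close>)

text \<open>Compatibility with the type class of real inner product spaces and with
  the standard inner product on the complex numbers.\<close>

definition real_ip_space :: "'a::real_inner ip_space" where
  "real_ip_space = \<lparr>carrier = UNIV, monoid.mult = (\<lambda>_ _. 0), one = 0, zero = 0, add = (+),
     smult = (\<lambda>c x. Re c *\<^sub>R x), ip = (\<lambda>x y. of_real (inner x y))\<rparr>"

lemma inner_product_space_real_ip_space:
  "inner_product_space \<real> (real_ip_space :: 'a::real_inner ip_space)"
  unfolding inner_product_space_def inner_product_space_axioms_def
proof (intro conjI moduleI abelian_groupI)
  show "cring (scalar_field \<real>)" by (rule cring_scalar_field) simp
next
  fix x :: 'a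
  show "\<exists>y\<in>carrier real_ip_space. y \<oplus>\<^bsub>real_ip_space\<^esub> x = \<zero>\<^bsub>real_ip_space\<^esub>"
    by (intro bexI[of _ "- x"]) (simp_all add: real_ip_space_def)
qed (auto simp: real_ip_space_def scalar_field_def algebra_simps inner_commute
       scaleR_add_left elim!: Reals_cases)

lemma ip_norm_real_ip_space: "ip_norm real_ip_space x = norm x"
  by (simp add: ip_norm_def real_ip_space_def norm_eq_sqrt_inner)

definition complex_ip_space :: "complex ip_space" where
  "complex_ip_space = \<lparr>carrier = UNIV, monoid.mult = (*), one = 1, zero = 0, add = (+),
     smult = (*), ip = (\<lambda>x y. x * cnj y)\<rparr>"

lemma inner_product_space_complex_ip_space: "inner_product_space UNIV complex_ip_space"
  unfolding inner_product_space_def inner_product_space_axioms_def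
proof (intro conjI moduleI abelian_groupI)
  show "cring (scalar_field UNIV)" by (rule cring_scalar_field) simp
next
  fix x :: complex
  show "\<exists>y\<in>carrier complex_ip_space. y \<oplus>\<^bsub>complex_ip_space\<^esub> x = \<zero>\<^bsub>complex_ip_space\<^esub>"
    by (intro bexI[of _ "- x"]) (simp_all add: complex_ip_space_def)
qed (auto simp: complex_ip_space_def scalar_field_def algebra_simps complex_eq_iff
       sum_power2_gt_zero_iff simp flip: power2_eq_square)

end

theory Submission
  imports Defs
begin

text \<open>
  Put \<open>u = x - \<langle>x, e\<rangle>e\<close> and \<open>v = y - \<langle>y, e\<rangle>e\<close>. The left-hand side is
  \<open>|\<langle>u, v\<rangle>| \<le> \<parallel>u\<parallel> \<parallel>v\<parallel>\<close>, where
  \<open>\<parallel>u\<parallel>\<^sup>2 = \<parallel>x\<parallel>\<^sup>2 - |\<langle>x, e\<rangle>|\<^sup>2 = (\<parallel>x\<parallel> - |\<langle>x, e\<rangle>|) (\<parallel>x\<parallel> + |\<langle>x, e\<rangle>|)\<close>. Expanding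
  \<open>\<parallel>x - e\<parallel>\<^sup>2 \<le> r\<^sup>2\<close> and using \<open>\<parallel>x\<parallel>\<^sup>2 + 1 \<ge> 2\<parallel>x\<parallel>\<close> bounds the first factor by \<open>r\<^sup>2 / 2\<close>.
  Equality holds for \<open>x = y\<close> a unit vector orthogonal to \<open>e\<close> and \<open>r\<^sub>1 = r\<^sub>2 = \<surd>2\<close>.
\<close>

context inner_product_space
begin

lemma carrier_scalar_field [simp]: "carrier (scalar_field K) = K"
  by (simp add: scalar_field_def)

lemma ip_smult_closed: "a \<in> K \<Longrightarrow> x \<in> carrier H \<Longrightarrow> a \<odot> x \<in> carrier H"
  using smult_closed by simp

text \<open>Additivity is applied to \<open>(x \<ominus> y) \<oplus> y = x\<close>, so no inner
  product with an additive inverse has to be computed.\<close>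

lemma ip_minus:
  assumes "x \<in> carrier H" "y \<in> carrier H" "z \<in> carrier H"
  shows "\<langle>x \<ominus> y, z\<rangle> = \<langle>x, z\<rangle> - \<langle>y, z\<rangle>"
proof -
  have "(x \<ominus> y) \<oplus> y = x"
    using assms by (simp add: M.minus_eq M.a_assoc M.l_neg)
  then show ?thesis
    using ip_add[of "x \<ominus> y" y z] assms by simp
qed

lemma ip_minus_right:
  assumes "x \<in> carrier H" "y \<in> carrier H" "z \<in> carrier H"
  shows "\<langle>z, x \<ominus> y\<rangle> = \<langle>z, x\<rangle> - \<langle>z, y\<rangle>"
  using assms ip_minus[of x y z] ip_cnj[of x z] ip_cnj[of y z] ip_cnj[of "x \<ominus> y" z] by simp

lemma ip_smult_right:
  assumes "a \<in> K" "x \<in> carrier H" "y \<in> carrier H"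
  shows "\<langle>x, a \<odot> y\<rangle> = cnj a * \<langle>x, y\<rangle>"
  using assms ip_smult[of a y x] ip_cnj[of "a \<odot> y" x] ip_cnj[of y x]
  by (simp add: ip_smult_closed)

lemma ip_zero: "x \<in> carrier H \<Longrightarrow> \<langle>x, \<zero>\<rangle> = 0"
  using ip_minus_right[of x x x] by (simp add: M.minus_eq M.r_neg)

lemma ip_nonneg: "x \<in> carrier H \<Longrightarrow> 0 \<le> Re \<langle>x, x\<rangle>"
  using ip_pos[of x] ip_zero[of x] by (cases "x = \<zero>") auto

lemma ip_norm_nonneg: "x \<in> carrier H \<Longrightarrow> 0 \<le> \<parallel>x\<parallel>"
  by (simp add: ip_norm_def ip_nonneg)

text \<open>Conjugate symmetry makes the imaginary part vanish, and \<open>ip_nonneg\<close> lets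
  the square undo the root in \<open>ip_norm\<close>.\<close>

lemma ip_self: "x \<in> carrier H \<Longrightarrow> \<langle>x, x\<rangle> = of_real (\<parallel>x\<parallel>\<^sup>2)"
  using ip_nonneg[of x] ip_cnj[of x x] by (simp add: ip_norm_def complex_eq_iff)

text \<open>In the expansion each of the three terms involving \<open>e\<close> is
  \<open>\<langle>x, e\<rangle> * \<langle>e, y\<rangle>\<close> up to sign, because
  \<open>\<langle>e, e\<rangle> = 1\<close>; two enter with a minus and one with a plus.\<close>

lemma ip_minus_proj:
  assumes "x \<in> carrier H" "y \<in> carrier H" "e \<in> carrier H" and e: "\<parallel>e\<parallel> = 1"
  shows "\<langle>x \<ominus> \<langle>x, e\<rangle> \<odot> e, y \<ominus> \<langle>y, e\<rangle> \<odot> e\<rangle> = \<langle>x, y\<rangle> - \<langle>x, e\<rangle> * \<langle>e, y\<rangle>"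
  using assms ip_self[of e] ip_cnj[of y e]
  by (simp add: ip_minus ip_minus_right ip_smult ip_smult_right ip_smult_closed ip_closed
      algebra_simps)

lemma norm_minus_proj:
  assumes "x \<in> carrier H" "e \<in> carrier H" and e: "\<parallel>e\<parallel> = 1"
  shows "\<parallel>x \<ominus> \<langle>x, e\<rangle> \<odot> e\<parallel>\<^sup>2 = \<parallel>x\<parallel>\<^sup>2 - (cmod \<langle>x, e\<rangle>)\<^sup>2"
proof -
  \<comment> \<open>This is \<open>ip_minus_proj\<close> with \<open>y = x\<close>. That equation is
    between complex numbers, so the real identity is obtained through its embedding.\<close>
  have "complex_of_real (\<parallel>x \<ominus> \<langle>x, e\<rangle> \<odot> e\<parallel>\<^sup>2) = of_real (\<parallel>x\<parallel>\<^sup>2 - (cmod \<langle>x, e\<rangle>)\<^sup>2)"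
    using assms ip_minus_proj[of x x e] ip_self[of x] ip_self[of "x \<ominus> \<langle>x, e\<rangle> \<odot> e"] ip_cnj[of x e]
    by (simp add: ip_smult_closed ip_closed complex_norm_square del: of_real_power)
  then show ?thesis
    by (simp only: of_real_eq_iff)
qed

text \<open>The Cauchy-Schwarz inequality for a unit vector: the squared norm in
  \<open>norm_minus_proj\<close> cannot be negative.\<close>

lemma norm_unit_ip_le:
  assumes "x \<in> carrier H" "e \<in> carrier H" and e: "\<parallel>e\<parallel> = 1"
  shows "cmod \<langle>x, e\<rangle> \<le> \<parallel>x\<parallel>"
proof (rule power2_le_imp_le)
  show "(cmod \<langle>x, e\<rangle>)\<^sup>2 \<le> \<parallel>x\<parallel>\<^sup>2"
    using norm_minus_proj[OF assms] zero_le_power2[of "\<parallel>x \<ominus> \<langle>x, e\<rangle> \<odot> e\<parallel>"] by linarith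
qed (use assms in \<open>simp add: ip_norm_nonneg\<close>)

text \<open>Rescaling \<open>y\<close> to norm one reduces the claim to
  \<open>norm_unit_ip_le\<close>; the zero vector is treated separately.\<close>

lemma Cauchy_Schwarz:
  assumes x: "x \<in> carrier H" and y: "y \<in> carrier H"
  shows "cmod \<langle>x, y\<rangle> \<le> \<parallel>x\<parallel> * \<parallel>y\<parallel>"
proof (cases "y = \<zero>")
  case True
  then show ?thesis
    using x y by (simp add: ip_zero ip_norm_nonneg)
next
  case False
  define t where "t = complex_of_real (1 / \<parallel>y\<parallel>)"
  have pos: "\<parallel>y\<parallel> > 0"
    using ip_pos[OF y False] by (simp add: ip_norm_def)
  \<comment> \<open>The normalising factor is real, hence an admissible scalar over both
    fields.\<close>
  have t: "t \<in> K"
    using K_cases by (auto simp: t_def)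
  have ty: "t \<odot> y \<in> carrier H"
    using t y by (rule ip_smult_closed)
  have "\<langle>t \<odot> y, t \<odot> y\<rangle> = 1"
    using pos t y ty ip_self[OF y] by (simp add: ip_smult ip_smult_right t_def power2_eq_square)
  then have "\<parallel>t \<odot> y\<parallel> = 1"
    by (simp add: ip_norm_def)
  then have "cmod \<langle>x, t \<odot> y\<rangle> \<le> \<parallel>x\<parallel>"
    using x ty by (intro norm_unit_ip_le)
  then show ?thesis
    using pos t x y by (simp add: ip_smult_right t_def norm_mult norm_divide field_simps)
qed

text \<open>The factor 1/2 stays under the root so that the estimates for \<open>x\<close> and
  \<open>y\<close> multiply to the constant 1/2 of the theorem.\<close>

lemma norm_minus_proj_le:
  assumes x: "x \<in> carrier H" and e: "e \<in> carrier H" "\<parallel>e\<parallel> = 1"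
    and r: "0 < r" "\<parallel>x \<ominus> e\<parallel> \<le> r"
  shows "\<parallel>x \<ominus> \<langle>x, e\<rangle> \<odot> e\<parallel> \<le> r * sqrt ((\<parallel>x\<parallel> + cmod \<langle>x, e\<rangle>) / 2)"
proof (rule power2_le_imp_le)
  let ?m = "cmod \<langle>x, e\<rangle>"
  have sum: "0 \<le> \<parallel>x\<parallel> + ?m"
    using x by (simp add: ip_norm_nonneg)
  \<comment> \<open>The two cross terms are conjugate to each other, so they add up to twice a real
    part.\<close>
  have "\<parallel>x \<ominus> e\<parallel>\<^sup>2 = \<parallel>x\<parallel>\<^sup>2 + 1 - 2 * Re \<langle>x, e\<rangle>"
    using x e arg_cong[OF ip_self[of "x \<ominus> e"], of Re] ip_self[of x] ip_self[of e] ip_cnj[of x e]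
    by (simp add: ip_minus ip_minus_right del: of_real_power)
  moreover have "\<parallel>x \<ominus> e\<parallel>\<^sup>2 \<le> r\<^sup>2"
    using r x e by (intro power_mono) (auto simp: ip_norm_nonneg)
  \<comment> \<open>This is the expanded form of
    \<open>0 \<le> (\<parallel>x\<parallel> - 1)\<^sup>2\<close>.\<close>
  moreover have "2 * \<parallel>x\<parallel> \<le> \<parallel>x\<parallel>\<^sup>2 + 1"
    using zero_le_power2[of "\<parallel>x\<parallel> - 1"] by (simp add: power2_diff)
  moreover have "Re \<langle>x, e\<rangle> \<le> ?m"
    by (rule complex_Re_le_cmod)
  ultimately have "\<parallel>x\<parallel> - ?m \<le> r\<^sup>2 / 2"
    by linarith
  \<comment> \<open>The left side is the difference of squares that \<open>norm_minus_proj\<close>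
    identifies with the squared norm to be bounded.\<close>
  then have "(\<parallel>x\<parallel> - ?m) * (\<parallel>x\<parallel> + ?m) \<le> r\<^sup>2 / 2 * (\<parallel>x\<parallel> + ?m)"
    using sum by (rule mult_right_mono)
  then show "\<parallel>x \<ominus> \<langle>x, e\<rangle> \<odot> e\<parallel>\<^sup>2 \<le> (r * sqrt ((\<parallel>x\<parallel> + ?m) / 2))\<^sup>2"
    using sum norm_minus_proj[OF x e]
    by (simp add: power_mult_distrib power2_eq_square algebra_simps)
  show "0 \<le> r * sqrt ((\<parallel>x\<parallel> + ?m) / 2)"
    using sum r by simp
qed

theorem ip_minus_proj_le:
  assumes x: "x \<in> carrier H" and y: "y \<in> carrier H" and e: "e \<in> carrier H" "\<parallel>e\<parallel> = 1"
    and r1: "0 < r1" "\<parallel>x \<ominus> e\<parallel> \<le> r1" and r2: "0 < r2" "\<parallel>y \<ominus> e\<parallel> \<le> r2"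
  shows "cmod (\<langle>x, y\<rangle> - \<langle>x, e\<rangle> * \<langle>e, y\<rangle>)
    \<le> 1 / 2 * r1 * r2 * sqrt (\<parallel>x\<parallel> + cmod \<langle>x, e\<rangle>) * sqrt (\<parallel>y\<parallel> + cmod \<langle>y, e\<rangle>)"
proof -
  let ?u = "x \<ominus> \<langle>x, e\<rangle> \<odot> e" and ?v = "y \<ominus> \<langle>y, e\<rangle> \<odot> e"
  have uv: "?u \<in> carrier H" "?v \<in> carrier H"
    using x y e by (auto simp: ip_smult_closed ip_closed)
  have "cmod (\<langle>x, y\<rangle> - \<langle>x, e\<rangle> * \<langle>e, y\<rangle>) \<le> \<parallel>?u\<parallel> * \<parallel>?v\<parallel>"
    using Cauchy_Schwarz[OF uv] ip_minus_proj[OF x y e] by simp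
  also have "\<dots> \<le> (r1 * sqrt ((\<parallel>x\<parallel> + cmod \<langle>x, e\<rangle>) / 2)) * (r2 * sqrt ((\<parallel>y\<parallel> + cmod \<langle>y, e\<rangle>) / 2))"
    using norm_minus_proj_le[OF x e r1] norm_minus_proj_le[OF y e r2] uv x r1
    by (intro mult_mono) (auto simp: ip_norm_nonneg)
  \<comment> \<open>Each root contributes a factor \<open>1 / sqrt 2\<close>.\<close>
  also have "\<dots> = 1 / 2 * r1 * r2 * sqrt (\<parallel>x\<parallel> + cmod \<langle>x, e\<rangle>) * sqrt (\<parallel>y\<parallel> + cmod \<langle>y, e\<rangle>)"
    by (simp add: real_sqrt_divide field_simps)
  finally show ?thesis .
qed

text \<open>By \<open>norm_unit_ip_le\<close> each sum under a root is at most twice the norm. The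
  resulting factor 2 cancels the constant 1/2 and gives the second inequality of the
  theorem.\<close>

lemma sqrt_norm_add_ip_le:
  assumes x: "x \<in> carrier H" and y: "y \<in> carrier H" and e: "e \<in> carrier H" "\<parallel>e\<parallel> = 1"
  shows "sqrt (\<parallel>x\<parallel> + cmod \<langle>x, e\<rangle>) * sqrt (\<parallel>y\<parallel> + cmod \<langle>y, e\<rangle>) \<le> 2 * sqrt (\<parallel>x\<parallel> * \<parallel>y\<parallel>)"
proof -
  have "sqrt (\<parallel>x\<parallel> + cmod \<langle>x, e\<rangle>) * sqrt (\<parallel>y\<parallel> + cmod \<langle>y, e\<rangle>) \<le> sqrt (2 * \<parallel>x\<parallel>) * sqrt (2 * \<parallel>y\<parallel>)"
    using norm_unit_ip_le[OF x e] norm_unit_ip_le[OF y e] x y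
    by (intro mult_mono) (auto simp: ip_norm_nonneg)
  also have "\<dots> = 2 * sqrt (\<parallel>x\<parallel> * \<parallel>y\<parallel>)"
    by (simp add: real_sqrt_mult)
  finally show ?thesis .
qed

end

text \<open>The space \<open>K\<close>-squared with its standard inner product. Vectors are stored
  as sequences vanishing from index 2 on, so that the carrier lies in the type over which the
  sharpness claim quantifies.\<close>

definition plane_ip_space :: "complex set \<Rightarrow> (nat \<Rightarrow> complex) ip_space" where
  "plane_ip_space K = \<lparr>carrier = {f. (\<forall>i. f i \<in> K) \<and> (\<forall>i\<ge>2. f i = 0)},
     monoid.mult = (\<lambda>_ _. undefined), one = undefined, zero = (\<lambda>_. 0), add = (\<lambda>f g i. f i + g i),
     smult = (\<lambda>c f i. c * f i), ip = (\<lambda>f g. f 0 * cnj (g 0) + f 1 * cnj (g 1))\<rparr>"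

lemma inner_product_space_plane_ip_space:
  assumes K: "K = \<real> \<or> K = UNIV"
  shows "inner_product_space K (plane_ip_space K)"
  unfolding inner_product_space_def inner_product_space_axioms_def
proof (intro conjI moduleI abelian_groupI allI impI)
  show "cring (scalar_field K)"
    using K by (rule cring_scalar_field)
next
  fix f assume "f \<in> carrier (plane_ip_space K)"
  then show "\<exists>g\<in>carrier (plane_ip_space K). g \<oplus>\<^bsub>plane_ip_space K\<^esub> f = \<zero>\<^bsub>plane_ip_space K\<^esub>"
    using K by (intro bexI[of _ "\<lambda>i. - f i"]) (auto simp: plane_ip_space_def)
next
  fix f assume f: "f \<in> carrier (plane_ip_space K)" "f \<noteq> \<zero>\<^bsub>plane_ip_space K\<^esub>"
  \<comment> \<open>Definiteness: the inner product sees only the entries 0 and 1, and membership in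
    the carrier forces a nonzero entry to be one of these.\<close>
  then obtain i where i: "f i \<noteq> 0" "\<And>j. 2 \<le> j \<Longrightarrow> f j = 0"
    by (auto simp: plane_ip_space_def fun_eq_iff)
  then have "i = 0 \<or> i = 1"
    by (metis One_nat_def Suc_1 less_2_cases_iff not_less)
  then have "f 0 \<noteq> 0 \<or> f 1 \<noteq> 0"
    using i by auto
  then have "0 < (cmod (f 0))\<^sup>2 + (cmod (f 1))\<^sup>2"
    by (simp add: sum_power2_gt_zero_iff)
  then show "0 < Re (\<langle>f, f\<rangle>\<^bsub>plane_ip_space K\<^esub>)"
    by (simp add: plane_ip_space_def cmod_power2 flip: power2_eq_square)
qed (use K in \<open>auto simp: plane_ip_space_def scalar_field_def algebra_simps Reals_cnj_iff
    intro!: ext\<close>)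

theorem theorem3:
  fixes K :: "complex set"
  assumes "K = \<real> \<or> K = UNIV"
  shows
    "(\<forall>(H :: 'v ip_space) x y e r1 r2.
        inner_product_space K H \<and> x \<in> carrier H \<and> y \<in> carrier H \<and> e \<in> carrier H \<and>
        \<parallel>e\<parallel>\<^bsub>H\<^esub> = 1 \<and> 0 < r1 \<and> 0 < r2 \<and>
        \<parallel>x \<ominus>\<^bsub>H\<^esub> e\<parallel>\<^bsub>H\<^esub> \<le> r1 \<and> \<parallel>y \<ominus>\<^bsub>H\<^esub> e\<parallel>\<^bsub>H\<^esub> \<le> r2 \<longrightarrow>
        cmod (\<langle>x, y\<rangle>\<^bsub>H\<^esub> - \<langle>x, e\<rangle>\<^bsub>H\<^esub> * \<langle>e, y\<rangle>\<^bsub>H\<^esub>)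
          \<le> 1 / 2 * r1 * r2 * sqrt (\<parallel>x\<parallel>\<^bsub>H\<^esub> + cmod \<langle>x, e\<rangle>\<^bsub>H\<^esub>) * sqrt (\<parallel>y\<parallel>\<^bsub>H\<^esub> + cmod \<langle>y, e\<rangle>\<^bsub>H\<^esub>) \<and>
        1 / 2 * r1 * r2 * sqrt (\<parallel>x\<parallel>\<^bsub>H\<^esub> + cmod \<langle>x, e\<rangle>\<^bsub>H\<^esub>) * sqrt (\<parallel>y\<parallel>\<^bsub>H\<^esub> + cmod \<langle>y, e\<rangle>\<^bsub>H\<^esub>)
          \<le> r1 * r2 * sqrt (\<parallel>x\<parallel>\<^bsub>H\<^esub> * \<parallel>y\<parallel>\<^bsub>H\<^esub>))
     \<and> \<not> (\<exists>c < 1 / 2. \<forall>(H :: (nat \<Rightarrow> complex) ip_space) x y e r1 r2.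
        inner_product_space K H \<and> x \<in> carrier H \<and> y \<in> carrier H \<and> e \<in> carrier H \<and>
        \<parallel>e\<parallel>\<^bsub>H\<^esub> = 1 \<and> 0 < r1 \<and> 0 < r2 \<and>
        \<parallel>x \<ominus>\<^bsub>H\<^esub> e\<parallel>\<^bsub>H\<^esub> \<le> r1 \<and> \<parallel>y \<ominus>\<^bsub>H\<^esub> e\<parallel>\<^bsub>H\<^esub> \<le> r2 \<longrightarrow>
        cmod (\<langle>x, y\<rangle>\<^bsub>H\<^esub> - \<langle>x, e\<rangle>\<^bsub>H\<^esub> * \<langle>e, y\<rangle>\<^bsub>H\<^esub>)
          \<le> c * r1 * r2 * sqrt (\<parallel>x\<parallel>\<^bsub>H\<^esub> + cmod \<langle>x, e\<rangle>\<^bsub>H\<^esub>) * sqrt (\<parallel>y\<parallel>\<^bsub>H\<^esub> + cmod \<langle>y, e\<rangle>\<^bsub>H\<^esub>))"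
proof (intro conjI allI impI notI)
  fix H :: "'v ip_space" and x y e r1 r2
  assume *: "inner_product_space K H \<and> x \<in> carrier H \<and> y \<in> carrier H \<and> e \<in> carrier H \<and>
    \<parallel>e\<parallel>\<^bsub>H\<^esub> = 1 \<and> 0 < r1 \<and> 0 < r2 \<and> \<parallel>x \<ominus>\<^bsub>H\<^esub> e\<parallel>\<^bsub>H\<^esub> \<le> r1 \<and> \<parallel>y \<ominus>\<^bsub>H\<^esub> e\<parallel>\<^bsub>H\<^esub> \<le> r2"
  then interpret inner_product_space K H
    by blast
  show "cmod (\<langle>x, y\<rangle>\<^bsub>H\<^esub> - \<langle>x, e\<rangle>\<^bsub>H\<^esub> * \<langle>e, y\<rangle>\<^bsub>H\<^esub>)
    \<le> 1 / 2 * r1 * r2 * sqrt (\<parallel>x\<parallel>\<^bsub>H\<^esub> + cmod \<langle>x, e\<rangle>\<^bsub>H\<^esub>) * sqrt (\<parallel>y\<parallel>\<^bsub>H\<^esub> + cmod \<langle>y, e\<rangle>\<^bsub>H\<^esub>)"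
    using * by (intro ip_minus_proj_le) auto
  \<comment> \<open>The two roots are grouped into one factor, which allows
    \<open>sqrt_norm_add_ip_le\<close> to be multiplied by the nonnegative number
    \<open>1 / 2 * r1 * r2\<close>.\<close>
  have "1 / 2 * r1 * r2 * (sqrt (\<parallel>x\<parallel>\<^bsub>H\<^esub> + cmod \<langle>x, e\<rangle>\<^bsub>H\<^esub>) * sqrt (\<parallel>y\<parallel>\<^bsub>H\<^esub> + cmod \<langle>y, e\<rangle>\<^bsub>H\<^esub>))
    \<le> 1 / 2 * r1 * r2 * (2 * sqrt (\<parallel>x\<parallel>\<^bsub>H\<^esub> * \<parallel>y\<parallel>\<^bsub>H\<^esub>))"
    using * by (intro mult_left_mono sqrt_norm_add_ip_le) auto
  then show "1 / 2 * r1 * r2 * sqrt (\<parallel>x\<parallel>\<^bsub>H\<^esub> + cmod \<langle>x, e\<rangle>\<^bsub>H\<^esub>) * sqrt (\<parallel>y\<parallel>\<^bsub>H\<^esub> + cmod \<langle>y, e\<rangle>\<^bsub>H\<^esub>)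
    \<le> r1 * r2 * sqrt (\<parallel>x\<parallel>\<^bsub>H\<^esub> * \<parallel>y\<parallel>\<^bsub>H\<^esub>)"
    by (simp add: mult.assoc)
next
  assume "\<exists>c < 1 / 2. \<forall>(H :: (nat \<Rightarrow> complex) ip_space) x y e r1 r2.
    inner_product_space K H \<and> x \<in> carrier H \<and> y \<in> carrier H \<and> e \<in> carrier H \<and>
    \<parallel>e\<parallel>\<^bsub>H\<^esub> = 1 \<and> 0 < r1 \<and> 0 < r2 \<and>
    \<parallel>x \<ominus>\<^bsub>H\<^esub> e\<parallel>\<^bsub>H\<^esub> \<le> r1 \<and> \<parallel>y \<ominus>\<^bsub>H\<^esub> e\<parallel>\<^bsub>H\<^esub> \<le> r2 \<longrightarrow>
    cmod (\<langle>x, y\<rangle>\<^bsub>H\<^esub> - \<langle>x, e\<rangle>\<^bsub>H\<^esub> * \<langle>e, y\<rangle>\<^bsub>H\<^esub>)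
      \<le> c * r1 * r2 * sqrt (\<parallel>x\<parallel>\<^bsub>H\<^esub> + cmod \<langle>x, e\<rangle>\<^bsub>H\<^esub>) * sqrt (\<parallel>y\<parallel>\<^bsub>H\<^esub> + cmod \<langle>y, e\<rangle>\<^bsub>H\<^esub>)"
  then obtain c :: real where c: "c < 1 / 2"
    and bound: "\<And>(H :: (nat \<Rightarrow> complex) ip_space) x y e r1 r2.
      \<lbrakk>inner_product_space K H; x \<in> carrier H; y \<in> carrier H; e \<in> carrier H;
       \<parallel>e\<parallel>\<^bsub>H\<^esub> = 1; 0 < r1; 0 < r2; \<parallel>x \<ominus>\<^bsub>H\<^esub> e\<parallel>\<^bsub>H\<^esub> \<le> r1; \<parallel>y \<ominus>\<^bsub>H\<^esub> e\<parallel>\<^bsub>H\<^esub> \<le> r2\<rbrakk> \<Longrightarrow>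
      cmod (\<langle>x, y\<rangle>\<^bsub>H\<^esub> - \<langle>x, e\<rangle>\<^bsub>H\<^esub> * \<langle>e, y\<rangle>\<^bsub>H\<^esub>)
        \<le> c * r1 * r2 * sqrt (\<parallel>x\<parallel>\<^bsub>H\<^esub> + cmod \<langle>x, e\<rangle>\<^bsub>H\<^esub>) * sqrt (\<parallel>y\<parallel>\<^bsub>H\<^esub> + cmod \<langle>y, e\<rangle>\<^bsub>H\<^esub>)"
    by blast
  let ?P = "plane_ip_space K"
  \<comment> \<open>These are the two standard basis vectors; their entries 0 and 1 belong to
    \<open>K\<close> in both cases.\<close>
  define e x :: "nat \<Rightarrow> complex" where "e = (\<lambda>i. of_bool (i = 0))" and "x = (\<lambda>i. of_bool (i = 1))"
  interpret P: inner_product_space K ?P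
    using assms by (rule inner_product_space_plane_ip_space)
  have carrier: "e \<in> carrier ?P" "x \<in> carrier ?P"
    using assms by (auto simp: e_def x_def plane_ip_space_def)
  have ips: "\<langle>x, x\<rangle>\<^bsub>?P\<^esub> = 1" "\<langle>e, e\<rangle>\<^bsub>?P\<^esub> = 1" "\<langle>x, e\<rangle>\<^bsub>?P\<^esub> = 0" "\<langle>e, x\<rangle>\<^bsub>?P\<^esub> = 0"
    by (auto simp: e_def x_def plane_ip_space_def)
  have norms: "\<parallel>e\<parallel>\<^bsub>?P\<^esub> = 1" "\<parallel>x\<parallel>\<^bsub>?P\<^esub> = 1" "\<parallel>x \<ominus>\<^bsub>?P\<^esub> e\<parallel>\<^bsub>?P\<^esub> = sqrt 2"
    using carrier by (simp_all add: ip_norm_def ips P.ip_minus P.ip_minus_right)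
  \<comment> \<open>With \<open>x\<close> also in the role of \<open>y\<close>, the left side of the
    bound and both roots of norms equal 1. The radii are the exact distance \<open>sqrt 2\<close>,
    so the bound forces \<open>1 \<le> 2 * c\<close>.\<close>
  have "1 \<le> c * sqrt 2 * sqrt 2"
    using bound[of ?P x x e "sqrt 2" "sqrt 2"] P.inner_product_space_axioms carrier
    by (simp add: norms ips)
  then show False
    using c by (simp add: mult.assoc)
qed

end
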